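(* Let $\varepsilon_k\to0$ and let $u_{\varepsilon_k}\in K$ be local minimizers of $J_{\varepsilon_k}$ with a uniform radius: there is $\delta>0$ such that for all $k$, $J_{\varepsilon_k}[u_{\varepsilon_k}]<J_{\varepsilon_k}[v]$ for all $v\in K$, $v\ne u_{\varepsilon_k}$, with $\|u_{\varepsilon_k}-v\|_{H^1}<\delta$. If $u_{\varepsilon_k}\to u$ in $H^1(\Omega)$, then $u$ is a local minimizer of $J$: $J[u]\le J[v]$ for all $v\in K$ with $\|v-u\|_{H^1}<\delta/2$.
   Context: $\Omega\subset\mathbb{R}^2$ is a bounded convex domain, $S\subsetneq\partial\Omega$. Fix $\lambda_1>\lambda_2>0$ and $\lambda(v)=\lambda_1$ if $v>0$, $\lambda(v)=\lambda_2$ if $v\le0$. $Q:\overline\Omega\to\mathbb{R}$ is measurable with $0<m\le Q\le M<\infty$ a.e. Given $u_0\in H^1(\Omega)$, $K=\{v\in H^1(\Omega): v|_S=u_0\}$ and $J[v]=\int_\Omega\big(|\nabla v|^2+Q^2(x)\lambda^2(v)\big)\,dx$. Let $\varphi_1\in C^{1,1}(\mathbb{R})$ be nondecreasing with $\varphi_1(v)=\lambda_1^2$ for $v\ge1$ and $\varphi_1(v)=\lambda_2^2$ for $v\le0$; for $\varepsilon>0$ set $\varphi_\varepsilon(v)=\varphi_1(v/\varepsilon)$ and $J_\varepsilon[v]=\int_\Omega\big(|\nabla v|^2+Q^2(x)\varphi_\varepsilon(v)\big)\,dx$. *)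

theory Defs
  imports "HOL-Analysis.Analysis"
begin

type_synonym R2 = "real^2"

definition pd :: "(R2 \<Rightarrow> real) \<Rightarrow> 2 \<Rightarrow> R2 \<Rightarrow> real" where
  "pd \<phi> i x = frechet_derivative \<phi> (at x) (axis i 1)"

definition smooth :: "(R2 \<Rightarrow> real) \<Rightarrow> bool" where
  "smooth \<phi> \<longleftrightarrow> (\<exists>F. \<phi> \<in> F \<and>
     (\<forall>\<psi>\<in>F. (\<forall>x. \<psi> differentiable (at x)) \<and> (\<forall>i. pd \<psi> i \<in> F)))"

definition test_fn :: "R2 set \<Rightarrow> (R2 \<Rightarrow> real) \<Rightarrow> bool" where
  "test_fn \<Omega> \<phi> \<longleftrightarrow> smooth \<phi> \<and> compact (closure {x. \<phi> x \<noteq> 0})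
     \<and> closure {x. \<phi> x \<noteq> 0} \<subseteq> \<Omega>"

definition weak_grad :: "R2 set \<Rightarrow> (R2 \<Rightarrow> real) \<Rightarrow> (R2 \<Rightarrow> R2) \<Rightarrow> bool" where
  "weak_grad \<Omega> f g \<longleftrightarrow> set_borel_measurable lebesgue \<Omega> g \<and>
     (\<forall>\<phi> i. test_fn \<Omega> \<phi> \<longrightarrow>
        set_integrable lebesgue \<Omega> (\<lambda>x. g x $ i * \<phi> x) \<and>
        set_integrable lebesgue \<Omega> (\<lambda>x. f x * pd \<phi> i x) \<and>
        (LINT x:\<Omega>|lebesgue. f x * pd \<phi> i x) = - (LINT x:\<Omega>|lebesgue. g x $ i * \<phi> x))"

definition grad :: "R2 set \<Rightarrow> (R2 \<Rightarrow> real) \<Rightarrow> (R2 \<Rightarrow> R2)" where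
  "grad \<Omega> f = (SOME g. weak_grad \<Omega> f g)"

definition H1 :: "R2 set \<Rightarrow> (R2 \<Rightarrow> real) set" where
  "H1 \<Omega> = {f. set_borel_measurable lebesgue \<Omega> f \<and>
     set_integrable lebesgue \<Omega> (\<lambda>x. (f x)\<^sup>2) \<and>
     (\<exists>g. weak_grad \<Omega> f g \<and> set_integrable lebesgue \<Omega> (\<lambda>x. (norm (g x))\<^sup>2))}"

definition H1_norm :: "R2 set \<Rightarrow> (R2 \<Rightarrow> real) \<Rightarrow> real" where
  "H1_norm \<Omega> f = sqrt ((LINT x:\<Omega>|lebesgue. (f x)\<^sup>2)
                      + (LINT x:\<Omega>|lebesgue. (norm (grad \<Omega> f x))\<^sup>2))"

definition H1_dist :: "R2 set \<Rightarrow> (R2 \<Rightarrow> real) \<Rightarrow> (R2 \<Rightarrow> real) \<Rightarrow> real" where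
  "H1_dist \<Omega> f g = H1_norm \<Omega> (\<lambda>x. f x - g x)"

definition trace_zero_on :: "R2 set \<Rightarrow> R2 set \<Rightarrow> (R2 \<Rightarrow> real) \<Rightarrow> bool" where
  "trace_zero_on \<Omega> S w \<longleftrightarrow> (\<exists>\<psi> :: nat \<Rightarrow> R2 \<Rightarrow> real.
     (\<forall>n. \<psi> n \<in> H1 \<Omega> \<and> continuous_on (closure \<Omega>) (\<psi> n) \<and> (\<forall>x\<in>S. \<psi> n x = 0)) \<and>
     (\<lambda>n. H1_dist \<Omega> (\<psi> n) w) \<longlonglongrightarrow> 0)"

definition admissible :: "R2 set \<Rightarrow> R2 set \<Rightarrow> (R2 \<Rightarrow> real) \<Rightarrow> (R2 \<Rightarrow> real) set" where
  "admissible \<Omega> S u0 = {v \<in> H1 \<Omega>. trace_zero_on \<Omega> S (\<lambda>x. v x - u0 x)}"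

definition lam :: "real \<Rightarrow> real \<Rightarrow> real \<Rightarrow> real" where
  "lam l1 l2 v = (if v > 0 then l1 else l2)"

definition Jfun :: "R2 set \<Rightarrow> (R2 \<Rightarrow> real) \<Rightarrow> real \<Rightarrow> real \<Rightarrow> (R2 \<Rightarrow> real) \<Rightarrow> real" where
  "Jfun \<Omega> Q l1 l2 v = (LINT x:\<Omega>|lebesgue.
      (norm (grad \<Omega> v x))\<^sup>2 + (Q x)\<^sup>2 * (lam l1 l2 (v x))\<^sup>2)"

definition Jeps :: "R2 set \<Rightarrow> (R2 \<Rightarrow> real) \<Rightarrow> (real \<Rightarrow> real) \<Rightarrow> real \<Rightarrow> (R2 \<Rightarrow> real) \<Rightarrow> real" where
  "Jeps \<Omega> Q \<phi>1 \<epsilon> v = (LINT x:\<Omega>|lebesgue.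
      (norm (grad \<Omega> v x))\<^sup>2 + (Q x)\<^sup>2 * \<phi>1 (v x / \<epsilon>))"

end

(*
Strict minimality of u_k in a ball of fixed radius delta gives J_k[u_k] <= J_k[v] for every competitor v
within delta/2 of u and all large k.  The right-hand side converges to J[v] by dominated convergence.  On
the left the Dirichlet energies converge.  For the potential pass to a subsequence converging a.e.: where
u > 0 the quotient u_k/eps_k tends to infinity, so the potential is eventually the limiting one, and where
u <= 0 the limiting potential is the minimal value, so min(potential of u_k, limiting potential) converges
to the limiting potential.

The energies and the H1 distance use a chosen weak gradient, so everything rests on the a.e. uniqueness
of weak gradients: a function orthogonal to all test functions vanishes a.e.
*)
theory Submission
  imports Defs
begin

section \<open>The space of square-integrable functions\<close>

lemma integrable_norm_add_square:
  fixes F G :: "'a \<Rightarrow> 'b::{banach, second_countable_topology}"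
  assumes [measurable]: "F \<in> borel_measurable M" "G \<in> borel_measurable M"
    and F: "integrable M (\<lambda>x. (norm (F x))\<^sup>2)" and G: "integrable M (\<lambda>x. (norm (G x))\<^sup>2)"
  shows "integrable M (\<lambda>x. (norm (F x + G x))\<^sup>2)"
proof (rule Bochner_Integration.integrable_bound)
  show "integrable M (\<lambda>x. 2 * (norm (F x))\<^sup>2 + 2 * (norm (G x))\<^sup>2)"
    using F G by simp
  show "AE x in M. norm ((norm (F x + G x))\<^sup>2) \<le> norm (2 * (norm (F x))\<^sup>2 + 2 * (norm (G x))\<^sup>2)"
  proof (rule AE_I2)
    fix x
    have "(norm (F x + G x))\<^sup>2 \<le> (norm (F x) + norm (G x))\<^sup>2"
      by (simp add: norm_triangle_ineq power_mono)
    also have "\<dots> \<le> 2 * (norm (F x))\<^sup>2 + 2 * (norm (G x))\<^sup>2"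
      using sum_squares_bound[of "norm (F x)" "norm (G x)"] by (simp add: power2_sum)
    finally show "norm ((norm (F x + G x))\<^sup>2) \<le> norm (2 * (norm (F x))\<^sup>2 + 2 * (norm (G x))\<^sup>2)"
      by simp
  qed
qed simp

definition L2_seminorm :: "'a measure \<Rightarrow> ('a \<Rightarrow> 'b::{banach, second_countable_topology}) \<Rightarrow> real" where
  "L2_seminorm M F = sqrt (\<integral>x. (norm (F x))\<^sup>2 \<partial>M)"

lemma L2_seminorm_nonneg: "0 \<le> L2_seminorm M F"
  by (simp add: L2_seminorm_def)

lemma L2_seminorm_square: "(L2_seminorm M F)\<^sup>2 = (\<integral>x. (norm (F x))\<^sup>2 \<partial>M)"
  by (simp add: L2_seminorm_def)

text \<open>Weighted Young inequality: (s + t)^2 is at most (1 + b/a) s^2 + (1 + a/b) t^2. With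
  weights \<open>a\<close>, \<open>b\<close> dominating the two seminorms, integration gives (a +
  b)^2 on the right, so no Cauchy-Schwarz inequality is used.\<close>

lemma L2_seminorm_triangle:
  fixes F G :: "'a \<Rightarrow> 'b::{banach, second_countable_topology}"
  assumes [measurable]: "F \<in> borel_measurable M" "G \<in> borel_measurable M"
    and F: "integrable M (\<lambda>x. (norm (F x))\<^sup>2)" and G: "integrable M (\<lambda>x. (norm (G x))\<^sup>2)"
  shows "L2_seminorm M (\<lambda>x. F x + G x) \<le> L2_seminorm M F + L2_seminorm M G"
proof (rule field_le_epsilon)
  fix e :: real assume "e > 0"
  \<comment> \<open>The surplus \<open>e / 2\<close> keeps both weights positive, hence legitimate
    divisors, even when a seminorm is zero.\<close>
  define a b where "a = L2_seminorm M F + e / 2" and "b = L2_seminorm M G + e / 2"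
  have pos: "a > 0" "b > 0"
    using \<open>e > 0\<close> L2_seminorm_nonneg[of M F] L2_seminorm_nonneg[of M G] by (auto simp: a_def b_def)
  have Fa: "(\<integral>x. (norm (F x))\<^sup>2 \<partial>M) \<le> a\<^sup>2" and Gb: "(\<integral>x. (norm (G x))\<^sup>2 \<partial>M) \<le> b\<^sup>2"
    unfolding L2_seminorm_square[symmetric]
    using \<open>e > 0\<close> by (auto simp: a_def b_def L2_seminorm_nonneg intro!: power_mono)
  have pointwise: "(norm (F x + G x))\<^sup>2 \<le> (1 + b / a) * (norm (F x))\<^sup>2 + (1 + a / b) * (norm (G x))\<^sup>2" for x
  proof -
    let ?s = "norm (F x)" and ?t = "norm (G x)"
    have "(1 + b / a) * ?s\<^sup>2 + (1 + a / b) * ?t\<^sup>2 - (?s + ?t)\<^sup>2 = (b * ?s - a * ?t)\<^sup>2 / (a * b)"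
      using pos by (simp add: field_simps power2_eq_square)
    also have "\<dots> \<ge> 0"
      using pos by simp
    finally have "(?s + ?t)\<^sup>2 \<le> (1 + b / a) * ?s\<^sup>2 + (1 + a / b) * ?t\<^sup>2" by simp
    with power_mono[OF norm_triangle_ineq norm_ge_zero, of "F x" "G x" 2] show ?thesis
      by (rule order_trans)
  qed
  have "(\<integral>x. (norm (F x + G x))\<^sup>2 \<partial>M)
      \<le> (\<integral>x. (1 + b / a) * (norm (F x))\<^sup>2 + (1 + a / b) * (norm (G x))\<^sup>2 \<partial>M)"
    using F G pointwise by (intro integral_mono integrable_norm_add_square) auto
  also have "\<dots> = (1 + b / a) * (\<integral>x. (norm (F x))\<^sup>2 \<partial>M) + (1 + a / b) * (\<integral>x. (norm (G x))\<^sup>2 \<partial>M)"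
    using F G by simp
  also have "\<dots> \<le> (1 + b / a) * a\<^sup>2 + (1 + a / b) * b\<^sup>2"
    using Fa Gb pos by (intro add_mono mult_left_mono) auto
  also have "\<dots> = (a + b)\<^sup>2"
    using pos by (simp add: field_simps power2_eq_square)
  finally have "L2_seminorm M (\<lambda>x. F x + G x) \<le> a + b"
    unfolding L2_seminorm_def using pos by (intro real_le_lsqrt) auto
  then show "L2_seminorm M (\<lambda>x. F x + G x) \<le> L2_seminorm M F + L2_seminorm M G + e"
    by (simp add: a_def b_def)
qed

text \<open>Dynkin's argument: open boxes are stable under intersection and generate the Borel sets,
  so vanishing box integrals force the integral over every Borel set to vanish, and a density is
  determined by these integrals.\<close>

lemma AE_eq_0_if_integral_box_eq_0:
  fixes k :: "'a::euclidean_space \<Rightarrow> real"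
  assumes k: "integrable lebesgue k"
    and zero: "\<And>a b. (LINT x:box a b|lebesgue. k x) = 0"
  shows "AE x in lebesgue. k x = 0"
proof -
  \<comment> \<open>The induction over the generated sigma-algebra reaches Borel sets only, so
    \<open>k\<close> is traded for an a.e. equal Borel function on \<open>lborel\<close>.\<close>
  obtain h where h[measurable]: "h \<in> borel_measurable lborel" and kh: "AE x in lborel. k x = h x"
    using completion_ex_borel_measurable_real[of k lborel] k by auto
  have kh': "AE x in lebesgue. k x = h x"
    by (rule AE_completion[OF kh])
  have "integrable lebesgue h"
    using integrable_cong_AE_imp[OF k] h kh' by (metis (no_types, lifting) AE_cong measurable_completion)
  then have hi: "integrable lborel h"
    by (simp add: integrable_completion)
  then have hset: "set_integrable lborel A h" if "A \<in> sets borel" for A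
    using that integrable_mult_indicator[of A lborel h] by (simp add: set_integrable_def)
  have box0: "(LINT x:box a b|lborel. h x) = 0" for a b
  proof -
    have "(LINT x:box a b|lborel. h x) = (LINT x:box a b|lebesgue. h x)"
      unfolding set_lebesgue_integral_def by (rule integral_completion[symmetric]) simp
    also have "\<dots> = (LINT x:box a b|lebesgue. k x)"
      unfolding set_lebesgue_integral_def
      using k kh' by (intro integral_cong_AE borel_measurable_scaleR borel_measurable_indicator)
        (auto intro: measurable_completion)
    finally show ?thesis using zero by simp
  qed
  \<comment> \<open>The complement case of the induction needs the integral over the whole space,
    obtained by exhausting it with growing boxes.\<close>
  have UNIV0: "(LINT x|lborel. h x) = 0"
  proof -
    let ?A = "\<lambda>n::nat. box (- (real n *\<^sub>R One)) (real n *\<^sub>R One) :: 'a set"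
    have "(\<lambda>n. LINT x:?A n|lborel. h x) \<longlonglongrightarrow> (LINT x:(\<Union>n. ?A n)|lborel. h x)"
      by (rule set_integral_cont_up) (auto simp: incseq_def box_def algebra_simps hset intro: less_le_trans le_less_trans mult_right_mono)
    then have "(LINT x:(\<Union>n. ?A n)|lborel. h x) = 0"
      by (simp add: box0 LIMSEQ_const_iff)
    then show ?thesis
      by (simp add: UN_box_eq_UNIV set_lebesgue_integral_def)
  qed
  have "(LINT x:A|lborel. h x) = 0" if "A \<in> sets borel" for A
  proof -
    let ?E = "range (\<lambda>(a, b). box a b::'a set)"
    have "Int_stable ?E" "?E \<subseteq> Pow UNIV" "A \<in> sigma_sets UNIV ?E"
      using that by (auto simp: Int_stable_def box_Int_box borel_eq_box)
    then show ?thesis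
    proof (induction rule: sigma_sets_induct_disjoint)
      case (basic A)
      then show ?case using box0 by auto
    next
      case empty
      show ?case by (simp add: set_lebesgue_integral_def)
    next
      case (compl A)
      then have A: "A \<in> sets borel"
        by (simp add: borel_eq_box)
      have "(LINT x:A \<union> (UNIV - A)|lborel. h x) = (LINT x:A|lborel. h x) + (LINT x:UNIV - A|lborel. h x)"
        using A by (intro set_integral_Un hset) auto
      then show ?case
        using compl UNIV0 by (simp add: set_lebesgue_integral_def)
    next
      case (union A)
      then have A: "A i \<in> sets borel" for i
        by (auto simp: borel_eq_box)
      have "(LINT x:(\<Union>i. A i)|lborel. h x) = (\<Sum>i. LINT x:A i|lborel. h x)"
        using A union.hyps(1) by (intro lebesgue_integral_countable_add hset) (auto simp: disjoint_family_on_def)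
      then show ?case
        using union by simp
    qed
  qed
  then have "AE x in lborel. h x = 0"
    using density_unique_real[of lborel h "\<lambda>_. 0"] hi by simp
  then show ?thesis
    using kh by (intro AE_completion) auto
qed

section \<open>Smooth bump functions\<close>

text \<open>For \<open>n = 0\<close> this is the classical smooth function that is flat at the
  origin. The powers in the denominator make the family closed under differentiation up to linear
  combinations.\<close>

definition flat :: "nat \<Rightarrow> real \<Rightarrow> real" where
  "flat n t = (if t > 0 then exp (- 1 / t) / t ^ n else 0)"

text \<open>The substitution s = 1/t turns the claim into the decay of s^n / exp s at
  infinity.\<close>

lemma flat_at_right_0: "(flat n \<longlongrightarrow> 0) (at_right 0)"
proof -
  have "((\<lambda>s::real. s ^ n / exp s) \<longlongrightarrow> 0) at_top"
    by (rule tendsto_power_div_exp_0)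
  then have "((\<lambda>t. inverse t ^ n / exp (inverse t)) \<longlongrightarrow> 0) (at_right (0::real))"
    by (rule filterlim_compose) (rule filterlim_inverse_at_top_right)
  then show ?thesis
    by (rule Lim_transform_eventually)
      (auto simp: eventually_at_right_less flat_def exp_minus field_simps inverse_eq_divide
        intro!: eventually_at_right_less[THEN eventually_mono])
qed

lemma has_real_derivative_flat:
  "(flat n has_real_derivative flat (n + 2) t - n * flat (n + 1) t) (at t)"
proof (cases t "0::real" rule: linorder_cases)
  case less
  have "((\<lambda>_. 0) has_real_derivative 0) (at t)" by simp
  then have "(flat n has_real_derivative 0) (at t)"
    using less by (elim has_field_derivative_transform_within_open[where S = "{..<0}"]) (auto simp: flat_def)
  then show ?thesis using less by (simp add: flat_def)
next
  case greater
  have "((\<lambda>t. exp (- 1 / t) / t ^ n) has_real_derivative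
      (exp (- 1 / t) * (1 / t\<^sup>2) * t ^ n - exp (- 1 / t) * (n * t ^ (n - 1))) / (t ^ n)\<^sup>2) (at t)"
    using greater by (auto intro!: derivative_eq_intros simp: power2_eq_square)
  \<comment> \<open>The case split on \<open>n\<close> handles the truncated exponent
    \<open>n - 1\<close> at \<open>n = 0\<close>, where the factor \<open>n\<close> removes the
    term.\<close>
  also have "(exp (- 1 / t) * (1 / t\<^sup>2) * t ^ n - exp (- 1 / t) * (n * t ^ (n - 1))) / (t ^ n)\<^sup>2
      = flat (n + 2) t - n * flat (n + 1) t"
    using greater by (cases n) (auto simp: flat_def field_simps power2_eq_square)
  finally show ?thesis
    using greater by (elim has_field_derivative_transform_within_open[where S = "{0<..}"]) (auto simp: flat_def)
next
  case equal
  have "(flat n has_real_derivative 0) (at 0)"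
    unfolding has_field_derivative_iff filterlim_at_split
  proof (intro conjI)
    have "((\<lambda>_. 0) \<longlongrightarrow> 0) (at_left (0::real))" by simp
    then show "((\<lambda>y. (flat n y - flat n 0) / (y - 0)) \<longlongrightarrow> 0) (at_left 0)"
      by (rule Lim_transform_eventually)
        (auto simp: eventually_at_left_field flat_def intro!: exI[of _ "-1"])
    \<comment> \<open>To the right of the origin the difference quotient of \<open>flat n\<close> is
      \<open>flat (Suc n)\<close>.\<close>
    show "((\<lambda>y. (flat n y - flat n 0) / (y - 0)) \<longlongrightarrow> 0) (at_right 0)"
      by (rule Lim_transform_eventually[OF flat_at_right_0[of "Suc n"]])
        (auto simp: flat_def field_simps intro!: eventually_at_right_less[THEN eventually_mono])
  qed
  then show ?thesis by (simp add: equal flat_def)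
qed

text \<open>A function algebra that is closed under partial derivatives witnesses smoothness, so no calculus of
  iterated derivatives is needed.\<close>

inductive flat_algebra :: "(R2 \<Rightarrow> real) \<Rightarrow> bool" where
  const: "flat_algebra (\<lambda>_. c)"
| flat: "flat_algebra (\<lambda>x. flat n (v \<bullet> x + d))"
| add: "flat_algebra f \<Longrightarrow> flat_algebra g \<Longrightarrow> flat_algebra (\<lambda>x. f x + g x)"
| mult: "flat_algebra f \<Longrightarrow> flat_algebra g \<Longrightarrow> flat_algebra (\<lambda>x. f x * g x)"

lemma pd_eqI: "(f has_derivative f') (at x) \<Longrightarrow> pd f i x = f' (axis i 1)"
  unfolding pd_def using frechet_derivative_at by metis

text \<open>Induction on the generation of the algebra: the chain rule sends a generator to a
  combination of generators with larger exponents, and the sum and product rules stay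
  inside.\<close>

lemma flat_algebra_differentiable_pd:
  assumes "flat_algebra f"
  shows "(\<forall>x. f differentiable (at x)) \<and> (\<forall>i. flat_algebra (pd f i))"
  using assms
proof induction
  case (const c)
  have "pd (\<lambda>_. c) i = (\<lambda>_. 0)" for i
    by (rule ext, subst pd_eqI[of _ "\<lambda>_. 0"]) auto
  then show ?case by (auto intro: flat_algebra.const)
next
  case (flat n v d)
  \<comment> \<open>Written as a sum with the constant factor \<open>- real n\<close>, because the
    algebra has rules for sums and products but not for differences.\<close>
  let ?f' = "\<lambda>x. flat (n + 2) (v \<bullet> x + d) + (- real n) * flat (n + 1) (v \<bullet> x + d)"
  have deriv: "((\<lambda>x. flat n (v \<bullet> x + d)) has_derivative (\<lambda>y. ?f' x * (v \<bullet> y))) (at x)" for x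
  proof -
    have "(flat n has_derivative (*) (?f' x)) (at (v \<bullet> x + d))"
      using has_real_derivative_flat[of n "v \<bullet> x + d"] by (simp add: has_field_derivative_def)
    moreover have "((\<lambda>x. v \<bullet> x + d) has_derivative (\<lambda>y. v \<bullet> y)) (at x)"
      by (auto intro!: derivative_eq_intros)
    ultimately show ?thesis
      using has_derivative_compose[of "\<lambda>x. v \<bullet> x + d" "\<lambda>y. v \<bullet> y" x UNIV "flat n" "(*) (?f' x)"] by simp
  qed
  have "pd (\<lambda>x. flat n (v \<bullet> x + d)) i = (\<lambda>x. ?f' x * (v \<bullet> axis i 1))" for i
    by (rule ext) (rule pd_eqI[OF deriv])
  moreover have "flat_algebra (\<lambda>x. ?f' x * (v \<bullet> axis i 1))" for i
    by (intro flat_algebra.intros)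
  moreover have "\<forall>x. (\<lambda>x. flat n (v \<bullet> x + d)) differentiable (at x)"
    using deriv by (blast intro: differentiableI)
  ultimately show ?case by (simp del: mult_minus_left add_uminus_conv_diff)
next
  case (add f g)
  then have "(f has_derivative frechet_derivative f (at x)) (at x)"
    "(g has_derivative frechet_derivative g (at x)) (at x)" for x
    by (auto simp: frechet_derivative_works[symmetric])
  then have "pd (\<lambda>x. f x + g x) i = (\<lambda>x. pd f i x + pd g i x)" for i
    by (intro ext) (auto simp: pd_def[of f] pd_def[of g] intro!: pd_eqI derivative_eq_intros)
  then show ?case
    using add by (auto intro: flat_algebra.intros)
next
  case (mult f g)
  then have "(f has_derivative frechet_derivative f (at x)) (at x)"
    "(g has_derivative frechet_derivative g (at x)) (at x)" for x
    by (auto simp: frechet_derivative_works[symmetric])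
  note * = has_derivative_mult[OF this]
  have "pd (\<lambda>x. f x * g x) i = (\<lambda>x. f x * pd g i x + pd f i x * g x)" for i
    by (rule ext, subst pd_eqI[OF *]) (simp add: pd_def)
  then show ?case
    using mult by (auto intro!: flat_algebra.intros)
qed

lemma smooth_if_flat_algebra: "flat_algebra f \<Longrightarrow> smooth f"
  unfolding smooth_def using flat_algebra_differentiable_pd by (intro exI[of _ "Collect flat_algebra"]) auto

text \<open>As \<open>r\<close> tends to infinity these bumps increase to the indicator of the open box with corners \<open>a\<close> and \<open>b\<close>.\<close>

definition box_bump :: "real \<Rightarrow> R2 \<Rightarrow> R2 \<Rightarrow> R2 \<Rightarrow> real" where
  "box_bump r a b x =
     flat 0 (r * (x $ 1 - a $ 1)) * flat 0 (r * (b $ 1 - x $ 1)) *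
     (flat 0 (r * (x $ 2 - a $ 2)) * flat 0 (r * (b $ 2 - x $ 2)))"

lemma flat_0_bounds: "0 \<le> flat 0 t" "flat 0 t \<le> 1"
  by (auto simp: flat_def)

lemma flat_algebra_box_bump: "flat_algebra (box_bump r a b)"
proof -
  have lower: "flat_algebra (\<lambda>x. flat 0 (r * (x $ i - c)))" for i c
    using flat_algebra.flat[of 0 "r *\<^sub>R axis i 1" "- r * c"] by (simp add: inner_axis' algebra_simps)
  have upper: "flat_algebra (\<lambda>x. flat 0 (r * (c - x $ i)))" for i c
    using flat_algebra.flat[of 0 "- r *\<^sub>R axis i 1" "r * c"] by (simp add: inner_axis' algebra_simps)
  show ?thesis
    unfolding box_bump_def[abs_def] by (intro flat_algebra.mult lower upper)
qed

lemma box_bump_le_1: "\<bar>box_bump r a b x\<bar> \<le> 1"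
  unfolding box_bump_def abs_mult
  using flat_0_bounds by (intro mult_le_one) (auto simp: abs_of_nonneg)

lemma box_bump_nonzero_iff:
  assumes "r > 0"
  shows "box_bump r a b x \<noteq> 0 \<longleftrightarrow> x \<in> box a b"
  using assms by (auto simp: box_bump_def mem_box_cart forall_2 flat_def zero_less_mult_iff)

text \<open>Inside the box every factor has the form exp (-1 / (r t)) with t > 0 and tends to 1;
  outside the box the product is zero at every scale. Using \<open>Suc n\<close> keeps the scale
  positive.\<close>

lemma box_bump_tendsto_indicator:
  "(\<lambda>n. box_bump (real (Suc n)) a b x) \<longlonglongrightarrow> indicator (box a b) x"
proof (cases "x \<in> box a b")
  case True
  have "(\<lambda>n. flat 0 (real (Suc n) * t)) \<longlonglongrightarrow> 1" if "t > 0" for t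
  proof -
    have "(\<lambda>n. exp (- (1 / t) * (1 / real (Suc n)))) \<longlonglongrightarrow> exp (- (1 / t) * 0)"
      by (intro tendsto_intros LIMSEQ_Suc lim_1_over_n)
    moreover have "flat 0 (real (Suc n) * t) = exp (- (1 / t) * (1 / real (Suc n)))" for n
      using that by (simp add: flat_def mult.commute)
    ultimately show ?thesis by simp
  qed
  then have "(\<lambda>n. box_bump (real (Suc n)) a b x) \<longlonglongrightarrow> 1 * 1 * (1 * 1)"
    unfolding box_bump_def using True by (intro tendsto_mult) (auto simp: mem_box_cart)
  then show ?thesis using True by simp
next
  case False
  then have "box_bump (real (Suc n)) a b x = 0" for n
    using box_bump_nonzero_iff[of "real (Suc n)" a b x] by simp
  then show ?thesis using False by simp
qed

text \<open>The bump at scale 1 acts as a cutoff: it turns any element of the algebra into a test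
  function, in particular another bump whose box need not lie inside the domain.\<close>

lemma test_fn_box_bump_mult:
  assumes "flat_algebra f" "cbox a b \<subseteq> \<Omega>"
  shows "test_fn \<Omega> (\<lambda>x. box_bump 1 a b x * f x)"
proof -
  have "closure {x. box_bump 1 a b x * f x \<noteq> 0} \<subseteq> cbox a b"
    using box_bump_nonzero_iff[of 1 a b] box_subset_cbox by (intro closure_minimal) auto
  moreover from this have "compact (closure {x. box_bump 1 a b x * f x \<noteq> 0})"
    by (meson bounded_cbox bounded_subset closed_closure compact_eq_bounded_closed)
  moreover have "smooth (\<lambda>x. box_bump 1 a b x * f x)"
    by (intro smooth_if_flat_algebra flat_algebra.mult flat_algebra_box_bump assms)
  ultimately show ?thesis
    using assms by (auto simp: test_fn_def)
qed

section \<open>Weak gradients and the Sobolev distance\<close>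

text \<open>Cut \<open>h\<close> off by a bump on a box inside the domain. The result is integrable
  on the whole plane and still orthogonal to all bumps, which approximate indicators of boxes, so
  its box integrals vanish. The cutoff is nonzero inside its box, and countably many boxes cover the
  domain.\<close>

lemma AE_eq_0_if_orthogonal_to_test_fns:
  fixes h :: "R2 \<Rightarrow> real"
  assumes "open \<Omega>"
    and int: "\<And>\<phi>. test_fn \<Omega> \<phi> \<Longrightarrow> integrable (lebesgue_on \<Omega>) (\<lambda>x. h x * \<phi> x)"
    and zero: "\<And>\<phi>. test_fn \<Omega> \<phi> \<Longrightarrow> (LINT x|lebesgue_on \<Omega>. h x * \<phi> x) = 0"
  shows "AE x in lebesgue_on \<Omega>. h x = 0"
proof -
  have \<Omega>: "\<Omega> \<inter> space lebesgue \<in> sets lebesgue"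
    using \<open>open \<Omega>\<close> by simp
  have box0: "AE x in lebesgue. x \<in> cbox a b \<longrightarrow> h x = 0" if sub: "cbox a b \<subseteq> \<Omega>" for a b
  proof -
    define k where "k x = indicator \<Omega> x * (h x * box_bump 1 a b x)" for x
    have "test_fn \<Omega> (\<lambda>x. box_bump 1 a b x * 1)"
      by (intro test_fn_box_bump_mult flat_algebra.const sub)
    then have k: "integrable lebesgue k"
      using int[of "box_bump 1 a b"] integrable_restrict_space[OF \<Omega>, of "\<lambda>x. h x * box_bump 1 a b x"]
      by (simp add: k_def[abs_def])
    \<comment> \<open>A product of the cutoff with a second bump is again a test function, so
      orthogonality survives the passage from \<open>h\<close> to \<open>k\<close>.\<close>
    have bump0: "(LINT x|lebesgue. box_bump r c d x * k x) = 0" for r c d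
      using zero[OF test_fn_box_bump_mult[OF flat_algebra_box_bump[of r c d] sub]]
      by (simp add: integral_restrict_space[OF \<Omega>] k_def ac_simps)
    have meas: "box_bump r c d \<in> borel_measurable lebesgue" for r c d
      using flat_algebra_differentiable_pd[OF flat_algebra_box_bump[of r c d]]
      by (intro continuous_imp_measurable_on_sets_lebesgue[where S = UNIV, unfolded lebesgue_on_UNIV_eq])
        (auto intro!: differentiable_imp_continuous_within continuous_at_imp_continuous_on)
    have "AE x in lebesgue. k x = 0"
    proof (rule AE_eq_0_if_integral_box_eq_0[OF k])
      fix c d
      have "(\<lambda>n. LINT x|lebesgue. box_bump (real (Suc n)) c d x * k x)
          \<longlonglongrightarrow> (LINT x|lebesgue. indicator (box c d) x * k x)"
      proof (rule integral_dominated_convergence[where w = "\<lambda>x. \<bar>k x\<bar>"])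
        show "AE x in lebesgue. norm (box_bump (real (Suc n)) c d x * k x) \<le> \<bar>k x\<bar>" for n
          using box_bump_le_1 by (auto simp: abs_mult intro!: mult_left_le_one_le)
        show "AE x in lebesgue. (\<lambda>n. box_bump (real (Suc n)) c d x * k x)
            \<longlonglongrightarrow> indicator (box c d) x * k x"
          by (intro AE_I2 tendsto_mult box_bump_tendsto_indicator tendsto_const)
      qed (use k meas in \<open>auto intro!: borel_measurable_times borel_measurable_indicator\<close>)
      then show "(LINT x:box c d|lebesgue. k x) = 0"
        by (simp add: bump0 LIMSEQ_const_iff set_lebesgue_integral_def)
    qed
    \<comment> \<open>The cutoff vanishes on the boundary of the box, which is a null set; the
      covering below consists of closed boxes.\<close>
    moreover have "AE x in lebesgue. x \<notin> cbox a b - box a b"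
      using negligible_frontier_interval[of a b] by (intro AE_not_in) (simp add: negligible_iff_null_sets)
    ultimately show ?thesis
    proof eventually_elim
      case (elim x)
      then show ?case
        using box_bump_nonzero_iff[of 1 a b x] sub by (auto simp: k_def)
    qed
  qed
  obtain \<D> where \<D>: "countable \<D>" "\<D> \<subseteq> Pow \<Omega>" "\<And>X. X \<in> \<D> \<Longrightarrow> \<exists>a b. X = cbox a b" "\<Union>\<D> = \<Omega>"
    using open_countable_Union_open_cbox[OF \<open>open \<Omega>\<close>] by metis
  have "\<forall>X\<in>\<D>. AE x in lebesgue. x \<in> X \<longrightarrow> h x = 0"
    using \<D>(2,3) box0 by (metis PowD subsetD)
  then have "AE x in lebesgue. \<forall>X\<in>\<D>. x \<in> X \<longrightarrow> h x = 0"
    unfolding AE_ball_countable[OF \<D>(1)] .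
  then show ?thesis
    using \<D>(4) by (subst AE_restrict_space_iff[OF \<Omega>]) auto
qed

text \<open>Moves from integrands with an indicator to the restricted measure, where measurability
  and integration rules apply directly.\<close>

lemma weak_grad_iff_lebesgue_on:
  assumes "open \<Omega>"
  shows "weak_grad \<Omega> f g \<longleftrightarrow> g \<in> borel_measurable (lebesgue_on \<Omega>) \<and>
     (\<forall>\<phi> i. test_fn \<Omega> \<phi> \<longrightarrow>
        integrable (lebesgue_on \<Omega>) (\<lambda>x. g x $ i * \<phi> x) \<and>
        integrable (lebesgue_on \<Omega>) (\<lambda>x. f x * pd \<phi> i x) \<and>
        (LINT x|lebesgue_on \<Omega>. f x * pd \<phi> i x) = - (LINT x|lebesgue_on \<Omega>. g x $ i * \<phi> x))"
proof -
  have "\<Omega> \<inter> space lebesgue \<in> sets lebesgue"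
    using assms by simp
  then show ?thesis
    unfolding weak_grad_def set_borel_measurable_def set_integrable_def set_lebesgue_integral_def
    by (simp add: borel_measurable_restrict_space_iff integrable_restrict_space integral_restrict_space)
qed

lemma weak_grad_measurable:
  "open \<Omega> \<Longrightarrow> weak_grad \<Omega> f g \<Longrightarrow> g \<in> borel_measurable (lebesgue_on \<Omega>)"
  unfolding weak_grad_iff_lebesgue_on by (rule conjunct1)

text \<open>Integrated against a test function, both gradients give the same value, fixed by
  \<open>f\<close> alone, so each component of their difference is orthogonal to all test
  functions.\<close>

lemma weak_grad_unique:
  assumes "open \<Omega>" "weak_grad \<Omega> f g" "weak_grad \<Omega> f g'"
  shows "AE x in lebesgue_on \<Omega>. g x = g' x"
proof -
  have "AE x in lebesgue_on \<Omega>. g x $ i - g' x $ i = 0" for i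
    using assms(2,3)
    by (intro AE_eq_0_if_orthogonal_to_test_fns \<open>open \<Omega>\<close>)
      (auto simp: weak_grad_iff_lebesgue_on[OF \<open>open \<Omega>\<close>] left_diff_distrib)
  then have "AE x in lebesgue_on \<Omega>. \<forall>i. g x $ i - g' x $ i = 0"
    by (simp add: AE_all_countable)
  then show ?thesis
    by (simp add: vec_eq_iff)
qed

lemma weak_grad_diff:
  assumes "open \<Omega>" "weak_grad \<Omega> f F" "weak_grad \<Omega> g G"
  shows "weak_grad \<Omega> (\<lambda>x. f x - g x) (\<lambda>x. F x - G x)"
  using assms(2,3) by (auto simp: weak_grad_iff_lebesgue_on[OF \<open>open \<Omega>\<close>] left_diff_distrib)

lemma smooth_pd_differentiable:
  assumes "smooth \<phi>"
  shows "pd \<phi> i differentiable (at x)"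
proof -
  from assms obtain F where "\<phi> \<in> F"
    and F: "\<forall>\<psi>\<in>F. (\<forall>x. \<psi> differentiable (at x)) \<and> (\<forall>i. pd \<psi> i \<in> F)"
    unfolding smooth_def by (elim exE conjE) (rule that)
  from F \<open>\<phi> \<in> F\<close> have "pd \<phi> i \<in> F" by simp
  with F show ?thesis by simp
qed

text \<open>A weak gradient sees the function only through integrals against
  \<open>pd \<phi> i\<close>. These factors are measurable because a partial derivative of a smooth
  function is again differentiable, hence continuous. The result makes the Dirichlet energy depend
  on the a.e. class only.\<close>

lemma weak_grad_cong_AE:
  assumes "open \<Omega>" and f: "f \<in> borel_measurable (lebesgue_on \<Omega>)"
    and eq: "AE x in lebesgue_on \<Omega>. f x = g x" and g: "weak_grad \<Omega> g G"
  shows "weak_grad \<Omega> f G"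
proof -
  have "integrable (lebesgue_on \<Omega>) (\<lambda>x. f x * pd \<phi> i x) \<and>
      (LINT x|lebesgue_on \<Omega>. f x * pd \<phi> i x) = (LINT x|lebesgue_on \<Omega>. g x * pd \<phi> i x)"
    if "test_fn \<Omega> \<phi>" for \<phi> i
  proof -
    have "continuous_on \<Omega> (pd \<phi> i)"
      using that smooth_pd_differentiable[of \<phi> i]
      by (auto simp: test_fn_def intro!: differentiable_imp_continuous_within continuous_at_imp_continuous_on)
    then have [measurable]: "pd \<phi> i \<in> borel_measurable (lebesgue_on \<Omega>)"
      using \<open>open \<Omega>\<close> by (intro continuous_imp_measurable_on_sets_lebesgue) auto
    have eq': "AE x in lebesgue_on \<Omega>. g x * pd \<phi> i x = f x * pd \<phi> i x"
      using eq by eventually_elim simp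
    have gi: "integrable (lebesgue_on \<Omega>) (\<lambda>x. g x * pd \<phi> i x)"
      using g that by (simp add: weak_grad_iff_lebesgue_on[OF \<open>open \<Omega>\<close>])
    have fm: "(\<lambda>x. f x * pd \<phi> i x) \<in> borel_measurable (lebesgue_on \<Omega>)"
      using f by simp
    show ?thesis
      using integrable_cong_AE_imp[OF gi fm eq']
        integral_cong_AE[OF borel_measurable_integrable[OF gi] fm eq'] by simp
  qed
  then show ?thesis
    using g by (simp add: weak_grad_iff_lebesgue_on[OF \<open>open \<Omega>\<close>])
qed

text \<open>The square-integrable gradient in the definition of \<open>H1\<close> is merely some
  weak gradient. By a.e. uniqueness the chosen one, \<open>grad\<close>, inherits its
  square-integrability.\<close>

lemma H1_iff_lebesgue_on:
  assumes "open \<Omega>"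
  shows "f \<in> H1 \<Omega> \<longleftrightarrow> f \<in> borel_measurable (lebesgue_on \<Omega>) \<and>
     integrable (lebesgue_on \<Omega>) (\<lambda>x. (f x)\<^sup>2) \<and>
     weak_grad \<Omega> f (grad \<Omega> f) \<and> integrable (lebesgue_on \<Omega>) (\<lambda>x. (norm (grad \<Omega> f x))\<^sup>2)"
proof -
  have \<Omega>: "\<Omega> \<inter> space lebesgue \<in> sets lebesgue"
    using assms by simp
  have "weak_grad \<Omega> f (grad \<Omega> f) \<and> integrable (lebesgue_on \<Omega>) (\<lambda>x. (norm (grad \<Omega> f x))\<^sup>2)"
    if g: "weak_grad \<Omega> f g" "integrable (lebesgue_on \<Omega>) (\<lambda>x. (norm (g x))\<^sup>2)" for g
  proof -
    have wg: "weak_grad \<Omega> f (grad \<Omega> f)"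
      unfolding grad_def by (rule someI[of "weak_grad \<Omega> f", OF g(1)])
    have "AE x in lebesgue_on \<Omega>. (norm (g x))\<^sup>2 = (norm (grad \<Omega> f x))\<^sup>2"
      using weak_grad_unique[OF assms g(1) wg] by eventually_elim simp
    moreover have "(\<lambda>x. (norm (grad \<Omega> f x))\<^sup>2) \<in> borel_measurable (lebesgue_on \<Omega>)"
      using weak_grad_measurable[OF assms wg] by measurable
    ultimately show ?thesis
      using wg integrable_cong_AE_imp[OF g(2)] by blast
  qed
  then show ?thesis
    unfolding H1_def set_borel_measurable_def set_integrable_def mem_Collect_eq
      borel_measurable_restrict_space_iff[OF \<Omega>] integrable_restrict_space[OF \<Omega>]
    by blast
qed

lemma
  assumes "open \<Omega>" "f \<in> H1 \<Omega>"
  shows H1_measurable: "f \<in> borel_measurable (lebesgue_on \<Omega>)"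
    and H1_weak_grad: "weak_grad \<Omega> f (grad \<Omega> f)"
    and H1_grad_measurable: "grad \<Omega> f \<in> borel_measurable (lebesgue_on \<Omega>)"
    and H1_integrable_square: "integrable (lebesgue_on \<Omega>) (\<lambda>x. (f x)\<^sup>2)"
    and H1_integrable_grad_square: "integrable (lebesgue_on \<Omega>) (\<lambda>x. (norm (grad \<Omega> f x))\<^sup>2)"
  using assms(2) weak_grad_measurable[OF assms(1)] unfolding H1_iff_lebesgue_on[OF assms(1)] by blast+

text \<open>The choice behind \<open>grad\<close> respects differences only almost everywhere: the
  difference of the two gradients is a weak gradient of the difference, and uniqueness identifies it
  with the chosen one.\<close>

lemma
  assumes "open \<Omega>" "f \<in> H1 \<Omega>" "g \<in> H1 \<Omega>"
  shows H1_diff: "(\<lambda>x. f x - g x) \<in> H1 \<Omega>"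
    and grad_diff: "AE x in lebesgue_on \<Omega>. grad \<Omega> (\<lambda>x. f x - g x) x = grad \<Omega> f x - grad \<Omega> g x"
proof -
  let ?N = "lebesgue_on \<Omega>"
  note H1 = H1_measurable[OF assms(1)] H1_grad_measurable[OF assms(1)]
    H1_integrable_square[OF assms(1)] H1_integrable_grad_square[OF assms(1)]
  have diff: "weak_grad \<Omega> (\<lambda>x. f x - g x) (\<lambda>x. grad \<Omega> f x - grad \<Omega> g x)"
    by (intro weak_grad_diff H1_weak_grad assms)
  then have diff': "weak_grad \<Omega> (\<lambda>x. f x - g x) (grad \<Omega> (\<lambda>x. f x - g x))"
    unfolding grad_def[of \<Omega> "\<lambda>x. f x - g x"]
    by (rule someI[of "weak_grad \<Omega> (\<lambda>x. f x - g x)"])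
  show eq: "AE x in ?N. grad \<Omega> (\<lambda>x. f x - g x) x = grad \<Omega> f x - grad \<Omega> g x"
    by (rule weak_grad_unique[OF \<open>open \<Omega>\<close> diff' diff])
  have "integrable ?N (\<lambda>x. (f x - g x)\<^sup>2)"
    using integrable_norm_add_square[of f ?N "\<lambda>x. - g x"] H1[OF assms(2)] H1[OF assms(3)] by simp
  moreover have "integrable ?N (\<lambda>x. (norm (grad \<Omega> f x - grad \<Omega> g x))\<^sup>2)"
    using integrable_norm_add_square[of "grad \<Omega> f" ?N "\<lambda>x. - grad \<Omega> g x"] H1[OF assms(2)] H1[OF assms(3)]
    by simp
  then have "integrable ?N (\<lambda>x. (norm (grad \<Omega> (\<lambda>x. f x - g x) x))\<^sup>2)"
    by (rule integrable_cong_AE_imp)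
      (use eq weak_grad_measurable[OF assms(1) diff'] in \<open>auto elim: eventually_mono\<close>)
  ultimately show "(\<lambda>x. f x - g x) \<in> H1 \<Omega>"
    using diff' borel_measurable_diff[OF H1(1)[OF assms(2)] H1(1)[OF assms(3)]]
    unfolding H1_iff_lebesgue_on[OF assms(1)] by blast
qed

text \<open>Pairing a function with its gradient turns the Sobolev norm into a single Lebesgue norm, so that its
  triangle inequality is Minkowski's.\<close>

definition jet :: "R2 set \<Rightarrow> (R2 \<Rightarrow> real) \<Rightarrow> R2 \<Rightarrow> real \<times> R2" where
  "jet \<Omega> f x = (f x, grad \<Omega> f x)"

lemma norm_jet_square: "(norm (jet \<Omega> f x))\<^sup>2 = (f x)\<^sup>2 + (norm (grad \<Omega> f x))\<^sup>2"
  by (simp add: jet_def norm_Pair)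

lemma jet_L2:
  assumes "open \<Omega>" "f \<in> H1 \<Omega>"
  shows "jet \<Omega> f \<in> borel_measurable (lebesgue_on \<Omega>)"
    and "integrable (lebesgue_on \<Omega>) (\<lambda>x. (norm (jet \<Omega> f x))\<^sup>2)"
  unfolding norm_jet_square unfolding jet_def[abs_def]
  by (intro borel_measurable_Pair Bochner_Integration.integrable_add H1_measurable H1_grad_measurable
      H1_integrable_square H1_integrable_grad_square assms)+

lemma H1_norm_eq_L2_seminorm_jet:
  assumes "open \<Omega>" "f \<in> H1 \<Omega>"
  shows "H1_norm \<Omega> f = L2_seminorm (lebesgue_on \<Omega>) (jet \<Omega> f)"
proof -
  have \<Omega>: "\<Omega> \<inter> space lebesgue \<in> sets lebesgue"
    using assms by simp
  have "H1_norm \<Omega> f = sqrt ((LINT x|lebesgue_on \<Omega>. (f x)\<^sup>2) + (LINT x|lebesgue_on \<Omega>. (norm (grad \<Omega> f x))\<^sup>2))"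
    by (simp add: H1_norm_def set_lebesgue_integral_def integral_restrict_space[OF \<Omega>])
  also have "\<dots> = L2_seminorm (lebesgue_on \<Omega>) (jet \<Omega> f)"
    using H1_integrable_square[OF assms] H1_integrable_grad_square[OF assms]
    by (simp add: L2_seminorm_def norm_jet_square)
  finally show ?thesis .
qed

lemma H1_dist_eq_L2_seminorm_jet:
  assumes "open \<Omega>" "f \<in> H1 \<Omega>" "g \<in> H1 \<Omega>"
  shows "H1_dist \<Omega> f g = L2_seminorm (lebesgue_on \<Omega>) (\<lambda>x. jet \<Omega> f x - jet \<Omega> g x)"
proof -
  have "AE x in lebesgue_on \<Omega>. (norm (jet \<Omega> (\<lambda>x. f x - g x) x))\<^sup>2 = (norm (jet \<Omega> f x - jet \<Omega> g x))\<^sup>2"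
    using grad_diff[OF assms] by eventually_elim (simp add: jet_def)
  then show ?thesis
    unfolding H1_dist_def H1_norm_eq_L2_seminorm_jet[OF assms(1) H1_diff[OF assms]] L2_seminorm_def
    using jet_L2[OF assms(1)] assms H1_diff[OF assms]
    by (intro arg_cong[where f = sqrt] integral_cong_AE) auto
qed

section \<open>Metric properties of the Sobolev distance and continuity of the Dirichlet
  energy\<close>

lemma H1_dist_commute:
  assumes "open \<Omega>" "f \<in> H1 \<Omega>" "g \<in> H1 \<Omega>"
  shows "H1_dist \<Omega> f g = H1_dist \<Omega> g f"
  using assms by (simp add: H1_dist_eq_L2_seminorm_jet L2_seminorm_def norm_minus_commute)

lemma H1_dist_triangle:
  assumes "open \<Omega>" "f \<in> H1 \<Omega>" "g \<in> H1 \<Omega>" "h \<in> H1 \<Omega>"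
  shows "H1_dist \<Omega> f h \<le> H1_dist \<Omega> f g + H1_dist \<Omega> g h"
proof -
  have "(\<lambda>x. jet \<Omega> p x - jet \<Omega> q x) \<in> borel_measurable (lebesgue_on \<Omega>)"
    "integrable (lebesgue_on \<Omega>) (\<lambda>x. (norm (jet \<Omega> p x - jet \<Omega> q x))\<^sup>2)"
    if "p \<in> H1 \<Omega>" "q \<in> H1 \<Omega>" for p q
    using jet_L2[OF \<open>open \<Omega>\<close>] that
      integrable_norm_add_square[of "jet \<Omega> p" "lebesgue_on \<Omega>" "\<lambda>x. - jet \<Omega> q x"] by auto
  from L2_seminorm_triangle[OF this(1)[OF assms(2,3)] this(1)[OF assms(3,4)]
      this(2)[OF assms(2,3)] this(2)[OF assms(3,4)]]
  show ?thesis
    using assms by (simp add: H1_dist_eq_L2_seminorm_jet)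
qed

lemma H1_dist_nonneg: "0 \<le> H1_dist \<Omega> f g"
  by (simp add: H1_dist_def H1_norm_def set_lebesgue_integral_def)

text \<open>The squared norm of the jet difference is the sum of these two nonnegative integrands,
  so it dominates each of them.\<close>

lemma
  assumes "open \<Omega>" "f \<in> H1 \<Omega>" "g \<in> H1 \<Omega>"
  shows integral_diff_square_le_H1_dist: "(LINT x|lebesgue_on \<Omega>. (f x - g x)\<^sup>2) \<le> (H1_dist \<Omega> f g)\<^sup>2"
    and integral_grad_diff_square_le_H1_dist:
      "(LINT x|lebesgue_on \<Omega>. (norm (grad \<Omega> f x - grad \<Omega> g x))\<^sup>2) \<le> (H1_dist \<Omega> f g)\<^sup>2"
proof -
  let ?N = "lebesgue_on \<Omega>" and ?D = "\<lambda>x. jet \<Omega> f x - jet \<Omega> g x"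
  note [measurable] = H1_measurable[OF assms(1,2)] H1_measurable[OF assms(1,3)]
    H1_grad_measurable[OF assms(1,2)] H1_grad_measurable[OF assms(1,3)]
  have int: "integrable ?N (\<lambda>x. (norm (?D x))\<^sup>2)"
    using jet_L2[OF assms(1)] assms(2,3)
      integrable_norm_add_square[of "jet \<Omega> f" ?N "\<lambda>x. - jet \<Omega> g x"] by auto
  have norm_D: "(norm (?D x))\<^sup>2 = (f x - g x)\<^sup>2 + (norm (grad \<Omega> f x - grad \<Omega> g x))\<^sup>2" for x
    by (simp add: jet_def norm_Pair)
  have bound: "(LINT x|?N. q x) \<le> (H1_dist \<Omega> f g)\<^sup>2"
    if "q \<in> borel_measurable ?N" "\<And>x. 0 \<le> q x" "\<And>x. q x \<le> (norm (?D x))\<^sup>2" for q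
  proof -
    have "integrable ?N q"
      using int that by (auto intro: Bochner_Integration.integrable_bound)
    then show ?thesis
      unfolding H1_dist_eq_L2_seminorm_jet[OF assms] L2_seminorm_square
      using int that by (intro integral_mono) auto
  qed
  show "(LINT x|?N. (f x - g x)\<^sup>2) \<le> (H1_dist \<Omega> f g)\<^sup>2"
    "(LINT x|?N. (norm (grad \<Omega> f x - grad \<Omega> g x))\<^sup>2) \<le> (H1_dist \<Omega> f g)\<^sup>2"
    by (intro bound; simp add: norm_D)+
qed

lemma L2_seminorm_grad_le:
  assumes "open \<Omega>" "f \<in> H1 \<Omega>" "g \<in> H1 \<Omega>"
  shows "L2_seminorm (lebesgue_on \<Omega>) (grad \<Omega> f) \<le> L2_seminorm (lebesgue_on \<Omega>) (grad \<Omega> g) + H1_dist \<Omega> f g"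
proof -
  let ?N = "lebesgue_on \<Omega>"
  note meas = H1_grad_measurable[OF assms(1,2)] H1_grad_measurable[OF assms(1,3)]
    and int = H1_integrable_grad_square[OF assms(1,2)] H1_integrable_grad_square[OF assms(1,3)]
  have "L2_seminorm ?N (\<lambda>x. grad \<Omega> g x + (grad \<Omega> f x - grad \<Omega> g x))
      \<le> L2_seminorm ?N (grad \<Omega> g) + L2_seminorm ?N (\<lambda>x. grad \<Omega> f x - grad \<Omega> g x)"
    using meas int integrable_norm_add_square[of "grad \<Omega> f" ?N "\<lambda>x. - grad \<Omega> g x"]
    by (intro L2_seminorm_triangle) auto
  moreover have "L2_seminorm ?N (\<lambda>x. grad \<Omega> f x - grad \<Omega> g x) \<le> H1_dist \<Omega> f g"
    unfolding L2_seminorm_def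
    by (intro real_le_lsqrt H1_dist_nonneg integral_grad_diff_square_le_H1_dist assms)
  ultimately show ?thesis by simp
qed

text \<open>Applying \<open>L2_seminorm_grad_le\<close> in both directions bounds the gap between
  the seminorms by the distance.\<close>

lemma L2_seminorm_grad_tendsto:
  assumes "open \<Omega>" "\<And>k. f k \<in> H1 \<Omega>" "g \<in> H1 \<Omega>" "(\<lambda>k. H1_dist \<Omega> (f k) g) \<longlonglongrightarrow> 0"
  shows "(\<lambda>k. L2_seminorm (lebesgue_on \<Omega>) (grad \<Omega> (f k))) \<longlonglongrightarrow> L2_seminorm (lebesgue_on \<Omega>) (grad \<Omega> g)"
proof (rule LIM_zero_cancel, rule Lim_null_comparison[OF _ assms(4)], rule always_eventually, rule allI)
  fix k
  show "norm (L2_seminorm (lebesgue_on \<Omega>) (grad \<Omega> (f k)) - L2_seminorm (lebesgue_on \<Omega>) (grad \<Omega> g))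
      \<le> H1_dist \<Omega> (f k) g"
    using L2_seminorm_grad_le[OF assms(1) assms(2)[of k] assms(3)]
      L2_seminorm_grad_le[OF assms(1,3) assms(2)[of k]] H1_dist_commute[OF assms(1) assms(2)[of k] assms(3)]
    by simp
qed

section \<open>Local minimizers in the limit\<close>

text \<open>Diagonal choice: for each \<open>k\<close> take an approximant within 1/(k+1) of
  \<open>w k\<close>; by the triangle inequality these approximants converge to the limit
  function.\<close>

lemma trace_zero_on_limit:
  assumes "open \<Omega>" and w: "\<And>k. w k \<in> H1 \<Omega>" "w' \<in> H1 \<Omega>"
    and trace: "\<And>k. trace_zero_on \<Omega> S (w k)" and lim: "(\<lambda>k. H1_dist \<Omega> (w k) w') \<longlonglongrightarrow> 0"
  shows "trace_zero_on \<Omega> S w'"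
proof -
  have "\<exists>\<psi>. \<psi> \<in> H1 \<Omega> \<and> continuous_on (closure \<Omega>) \<psi> \<and> (\<forall>x\<in>S. \<psi> x = 0) \<and>
      H1_dist \<Omega> \<psi> (w k) < 1 / real (Suc k)" for k
  proof -
    obtain \<psi> where \<psi>: "\<And>n. \<psi> n \<in> H1 \<Omega> \<and> continuous_on (closure \<Omega>) (\<psi> n) \<and> (\<forall>x\<in>S. \<psi> n x = 0)"
      "(\<lambda>n. H1_dist \<Omega> (\<psi> n) (w k)) \<longlonglongrightarrow> 0"
      using trace[of k] unfolding trace_zero_on_def by blast
    then have "\<forall>\<^sub>F n in sequentially. H1_dist \<Omega> (\<psi> n) (w k) < 1 / real (Suc k)"
      by (intro order_tendstoD(2)) auto
    then show ?thesis
      using \<psi>(1) by (auto simp: eventually_sequentially)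
  qed
  then obtain \<psi> where \<psi>: "\<And>k. \<psi> k \<in> H1 \<Omega>" "\<And>k. continuous_on (closure \<Omega>) (\<psi> k)"
    "\<And>k. \<forall>x\<in>S. \<psi> k x = 0" "\<And>k. H1_dist \<Omega> (\<psi> k) (w k) < 1 / real (Suc k)"
    by metis
  have "(\<lambda>k. H1_dist \<Omega> (\<psi> k) w') \<longlonglongrightarrow> 0"
  proof (rule Lim_null_comparison)
    show "\<forall>\<^sub>F k in sequentially. norm (H1_dist \<Omega> (\<psi> k) w') \<le> 1 / real (Suc k) + H1_dist \<Omega> (w k) w'"
    proof (rule always_eventually, rule allI)
      fix k
      show "norm (H1_dist \<Omega> (\<psi> k) w') \<le> 1 / real (Suc k) + H1_dist \<Omega> (w k) w'"
        using H1_dist_triangle[OF \<open>open \<Omega>\<close> \<psi>(1)[of k] w(1)[of k] w(2)] \<psi>(4)[of k]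
          H1_dist_nonneg[of \<Omega> "\<psi> k" w'] by simp
    qed
    show "(\<lambda>k. 1 / real (Suc k) + H1_dist \<Omega> (w k) w') \<longlonglongrightarrow> 0"
      using tendsto_add[OF LIMSEQ_Suc[OF lim_1_over_n] lim] by simp
  qed
  then show ?thesis
    unfolding trace_zero_on_def using \<psi> by blast
qed

text \<open>Subtracting \<open>u0\<close> from both arguments cancels in their difference, so the
  distances are unchanged and the closedness of the trace condition applies.\<close>

lemma admissible_limit:
  assumes "open \<Omega>" "u0 \<in> H1 \<Omega>" "\<And>k. w k \<in> admissible \<Omega> S u0" "w' \<in> H1 \<Omega>"
    and lim: "(\<lambda>k. H1_dist \<Omega> (w k) w') \<longlonglongrightarrow> 0"
  shows "w' \<in> admissible \<Omega> S u0"
proof -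
  have "trace_zero_on \<Omega> S (\<lambda>x. w' x - u0 x)"
  proof (rule trace_zero_on_limit[OF \<open>open \<Omega>\<close>])
    show "(\<lambda>k. H1_dist \<Omega> (\<lambda>x. w k x - u0 x) (\<lambda>x. w' x - u0 x)) \<longlonglongrightarrow> 0"
      using lim by (simp add: H1_dist_def)
  qed (use assms H1_diff in \<open>auto simp: admissible_def\<close>)
  then show ?thesis
    using assms by (simp add: admissible_def)
qed

section \<open>Bounded potentials, splitting of the energy and rescaled arguments\<close>

lemma integrable_bounded_mult:
  fixes W p :: "'a \<Rightarrow> real"
  assumes "finite_measure N" "W \<in> borel_measurable N" "p \<in> borel_measurable N"
    and "AE x in N. \<bar>W x\<bar> \<le> C" "\<And>x. \<bar>p x\<bar> \<le> B"
  shows "integrable N (\<lambda>x. W x * p x)"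
proof (rule finite_measure.integrable_const_bound[OF assms(1)])
  show "AE x in N. norm (W x * p x) \<le> C * B"
    using assms(4)
  proof eventually_elim
    case (elim x)
    then show ?case
      using mult_mono[of "\<bar>W x\<bar>" C "\<bar>p x\<bar>" B] assms(5)[of x] by (simp add: abs_mult)
  qed
qed (use assms in simp)

text \<open>Dominated convergence with a constant majorant on a finite measure. In the application
  \<open>W\<close> is the square of \<open>Q\<close>, bounded only almost everywhere, while the
  \<open>q n\<close> are potential values with a uniform bound.\<close>

lemma integral_bounded_mult_tendsto:
  fixes W p :: "'a \<Rightarrow> real"
  assumes "finite_measure N" "W \<in> borel_measurable N" "\<And>n. q n \<in> borel_measurable N" "p \<in> borel_measurable N"
    and W: "AE x in N. \<bar>W x\<bar> \<le> C" and B: "\<And>n x. \<bar>q n x\<bar> \<le> B"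
    and lim: "AE x in N. (\<lambda>n. q n x) \<longlonglongrightarrow> p x"
  shows "(\<lambda>n. LINT x|N. W x * q n x) \<longlonglongrightarrow> (LINT x|N. W x * p x)"
proof (rule integral_dominated_convergence[where w = "\<lambda>_. C * B"])
  show "integrable N (\<lambda>_. C * B)"
    using assms(1) by (simp add: finite_measure.integrable_const)
  show "AE x in N. (\<lambda>n. W x * q n x) \<longlonglongrightarrow> W x * p x"
    using lim by eventually_elim (intro tendsto_intros)
  show "AE x in N. norm (W x * q n x) \<le> C * B" for n
    using W
  proof eventually_elim
    case (elim x)
    then show ?case
      using mult_mono[of "\<bar>W x\<bar>" C "\<bar>q n x\<bar>" B] B[of n x] by (simp add: abs_mult)
  qed
qed (use assms in simp_all)

lemma energy_eq:
  assumes "open \<Omega>" "v \<in> H1 \<Omega>" "integrable (lebesgue_on \<Omega>) p"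
  shows "(LINT x:\<Omega>|lebesgue. (norm (grad \<Omega> v x))\<^sup>2 + p x)
      = (L2_seminorm (lebesgue_on \<Omega>) (grad \<Omega> v))\<^sup>2 + (LINT x|lebesgue_on \<Omega>. p x)"
proof -
  have \<Omega>: "\<Omega> \<inter> space lebesgue \<in> sets lebesgue"
    using assms(1) by simp
  show ?thesis
    using H1_integrable_grad_square[OF assms(1,2)] assms(3)
    by (simp add: L2_seminorm_square set_lebesgue_integral_def
        integral_restrict_space[OF \<Omega>, symmetric] del: real_scaleR_def)
qed

lemma L2_seminorm_grad_cong_AE:
  assumes "open \<Omega>" "f \<in> H1 \<Omega>" "g \<in> H1 \<Omega>" "AE x in lebesgue_on \<Omega>. f x = g x"
  shows "L2_seminorm (lebesgue_on \<Omega>) (grad \<Omega> f) = L2_seminorm (lebesgue_on \<Omega>) (grad \<Omega> g)"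
proof -
  have "AE x in lebesgue_on \<Omega>. grad \<Omega> f x = grad \<Omega> g x"
    by (rule weak_grad_unique[OF assms(1) H1_weak_grad[OF assms(1,2)]
          weak_grad_cong_AE[OF assms(1) H1_measurable[OF assms(1,2)] assms(4) H1_weak_grad[OF assms(1,3)]]])
  then have "AE x in lebesgue_on \<Omega>. (norm (grad \<Omega> f x))\<^sup>2 = (norm (grad \<Omega> g x))\<^sup>2"
    by eventually_elim simp
  then show ?thesis
    unfolding L2_seminorm_def using H1_grad_measurable[OF assms(1,2)] H1_grad_measurable[OF assms(1,3)]
    by (intro arg_cong[where f = sqrt] integral_cong_AE) auto
qed

text \<open>The difference \<open>X k - \<epsilon> k\<close> tends to a positive limit, so the
  numerator eventually exceeds the denominator.\<close>

lemma eventually_scaled_ge_1: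
  fixes X :: "nat \<Rightarrow> real"
  assumes "X \<longlonglongrightarrow> x" "x > 0" "\<And>k. \<epsilon> k > 0" "\<epsilon> \<longlonglongrightarrow> 0"
  shows "\<forall>\<^sub>F k in sequentially. 1 \<le> X k / \<epsilon> k"
proof -
  have "(\<lambda>k. X k - \<epsilon> k) \<longlonglongrightarrow> x - 0"
    by (intro tendsto_intros assms)
  then have "\<forall>\<^sub>F k in sequentially. 0 < X k - \<epsilon> k"
    using \<open>x > 0\<close> by (intro order_tendstoD(1)) auto
  then show ?thesis
    by eventually_elim (use assms(3) in \<open>auto simp: field_simps intro: less_imp_le\<close>)
qed

theorem mainTheorem6:
  fixes \<Omega> S :: "R2 set" and Q :: "R2 \<Rightarrow> real" and u0 u :: "R2 \<Rightarrow> real"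
    and uk :: "nat \<Rightarrow> R2 \<Rightarrow> real" and \<phi>1 :: "real \<Rightarrow> real"
    and lam1 lam2 m M \<delta> :: real and \<epsilon> :: "nat \<Rightarrow> real"
  assumes dom: "open \<Omega>" "connected \<Omega>" "\<Omega> \<noteq> {}" "bounded \<Omega>" "convex \<Omega>"
    and S: "S \<subseteq> frontier \<Omega>" "S \<noteq> frontier \<Omega>"
    and lam: "lam1 > lam2" "lam2 > 0"
    and Q: "set_borel_measurable lebesgue (closure \<Omega>) Q" "0 < m" "m \<le> M"
       "AE x in lebesgue. x \<in> closure \<Omega> \<longrightarrow> m \<le> Q x \<and> Q x \<le> M"
    and u0: "u0 \<in> H1 \<Omega>"
    and phi: "\<And>x. \<phi>1 differentiable (at x)" "\<exists>L. lipschitz_on L UNIV (deriv \<phi>1)"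
       "mono \<phi>1" "\<And>v. v \<ge> 1 \<Longrightarrow> \<phi>1 v = lam1\<^sup>2" "\<And>v. v \<le> 0 \<Longrightarrow> \<phi>1 v = lam2\<^sup>2"
    and eps: "\<And>k. \<epsilon> k > 0" "\<epsilon> \<longlonglongrightarrow> 0"
    and delta: "\<delta> > 0"
    and locmin: "\<And>k. uk k \<in> admissible \<Omega> S u0"
       "\<And>k v. v \<in> admissible \<Omega> S u0 \<Longrightarrow>
          \<not> (AE x in lebesgue. x \<in> \<Omega> \<longrightarrow> v x = uk k x) \<Longrightarrow>
          H1_dist \<Omega> (uk k) v < \<delta> \<Longrightarrow>
          Jeps \<Omega> Q \<phi>1 (\<epsilon> k) (uk k) < Jeps \<Omega> Q \<phi>1 (\<epsilon> k) v"
    and u: "u \<in> H1 \<Omega>" "(\<lambda>k. H1_dist \<Omega> (uk k) u) \<longlonglongrightarrow> 0"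
  shows "u \<in> admissible \<Omega> S u0 \<and>
    (\<forall>v \<in> admissible \<Omega> S u0. H1_dist \<Omega> v u < \<delta> / 2 \<longrightarrow>
       Jfun \<Omega> Q lam1 lam2 u \<le> Jfun \<Omega> Q lam1 lam2 v)"
proof (intro conjI ballI impI)
  note dom = \<open>open \<Omega>\<close> \<open>bounded \<Omega>\<close>
  show "u \<in> admissible \<Omega> S u0"
    by (rule admissible_limit[OF dom(1) u0 locmin(1) u])

  define N where "N = lebesgue_on \<Omega>"
  have \<Omega>: "\<Omega> \<inter> space lebesgue \<in> sets lebesgue"
    using dom by simp
  have fin: "finite_measure N"
    unfolding N_def using dom by (intro finite_measure_lebesgue_on lmeasurable_open)
  have "Q \<in> borel_measurable (lebesgue_on (closure \<Omega>))"
    using Q(1) by (simp add: set_borel_measurable_def borel_measurable_restrict_space_iff)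
  then have [measurable]: "Q \<in> borel_measurable N"
    unfolding N_def by (rule measurable_restrict_mono) (rule closure_subset)
  \<comment> \<open>Positivity of \<open>m\<close> makes \<open>Q x\<close> nonnegative, so the
    upper bound \<open>M\<close> survives squaring.\<close>
  have QM: "AE x in N. \<bar>(Q x)\<^sup>2\<bar> \<le> M\<^sup>2"
    unfolding N_def AE_restrict_space_iff[OF \<Omega>] using Q(4)
    by eventually_elim (use closure_subset \<open>0 < m\<close> in \<open>fastforce intro: power_mono\<close>)
  have [measurable]: "\<phi>1 \<in> borel_measurable borel"
    using \<open>mono \<phi>1\<close> by (rule borel_measurable_mono)
  have [measurable]: "lam lam1 lam2 \<in> borel_measurable borel"
    unfolding lam_def[abs_def] by measurable
  have H1_meas: "w \<in> borel_measurable N" if "w \<in> H1 \<Omega>" for w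
    using H1_measurable[OF dom(1) that] by (simp add: N_def)
  \<comment> \<open>Comparing \<open>t\<close> with \<open>min t 0\<close>, and below with
    \<open>max t 1\<close>, uses monotonicity against points where \<open>\<phi>1\<close> is already
    constant and gives global bounds.\<close>
  have phi_ge: "lam2\<^sup>2 \<le> \<phi>1 t" for t
    using monoD[OF phi(3), of "min t 0" t] phi(5)[of "min t 0"] by simp
  have phi_le: "\<bar>\<phi>1 t\<bar> \<le> lam1\<^sup>2" for t
    using monoD[OF phi(3), of t "max t 1"] phi(4)[of "max t 1"] order_trans[OF zero_le_power2 phi_ge[of t]]
    by simp
  have lam_sq: "lam2\<^sup>2 \<le> lam1\<^sup>2"
    using lam by (intro power_mono) auto
  have lam_bound: "\<bar>(lam lam1 lam2 t)\<^sup>2\<bar> \<le> lam1\<^sup>2" for t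
    using lam_sq by (simp add: lam_def)
  have uk: "uk k \<in> H1 \<Omega>" for k
    using locmin(1) by (simp add: admissible_def)
  have phi_int: "integrable N (\<lambda>x. (Q x)\<^sup>2 * \<phi>1 (w x / e))" if "w \<in> H1 \<Omega>" for w e
    using H1_meas[OF that] phi_le by (intro integrable_bounded_mult[OF fin _ _ QM]) auto
  have lam_int: "integrable N (\<lambda>x. (Q x)\<^sup>2 * (lam lam1 lam2 (w x))\<^sup>2)" if "w \<in> H1 \<Omega>" for w
    using H1_meas[OF that] lam_bound by (intro integrable_bounded_mult[OF fin _ _ QM]) auto
  have Jeps_eq: "Jeps \<Omega> Q \<phi>1 e w = (L2_seminorm N (grad \<Omega> w))\<^sup>2 + (LINT x|N. (Q x)\<^sup>2 * \<phi>1 (w x / e))"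
    if "w \<in> H1 \<Omega>" for w e
    unfolding Jeps_def N_def using phi_int[OF that] by (intro energy_eq dom that) (simp add: N_def)
  have Jfun_eq: "Jfun \<Omega> Q lam1 lam2 w = (L2_seminorm N (grad \<Omega> w))\<^sup>2 + (LINT x|N. (Q x)\<^sup>2 * (lam lam1 lam2 (w x))\<^sup>2)"
    if "w \<in> H1 \<Omega>" for w
    unfolding Jfun_def N_def using lam_int[OF that] by (intro energy_eq dom that) (simp add: N_def)

  fix v assume v: "v \<in> admissible \<Omega> S u0" and close: "H1_dist \<Omega> v u < \<delta> / 2"
  have vH: "v \<in> H1 \<Omega>"
    using v by (simp add: admissible_def)
  have Jeps_le: "\<forall>\<^sub>F k in sequentially. Jeps \<Omega> Q \<phi>1 (\<epsilon> k) (uk k) \<le> Jeps \<Omega> Q \<phi>1 (\<epsilon> k) v"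
  proof -
    have "\<forall>\<^sub>F k in sequentially. H1_dist \<Omega> (uk k) u < \<delta> / 2"
      using u(2) delta by (intro order_tendstoD(2)) auto
    then show ?thesis
    proof eventually_elim
      case (elim k)
      have "H1_dist \<Omega> (uk k) v < \<delta>"
        using H1_dist_triangle[OF dom(1) uk u(1) vH, of k] H1_dist_commute[OF dom(1) u(1) vH] elim close
        by simp
      \<comment> \<open>Strict minimality is silent about a competitor that equals
        \<open>uk k\<close> almost everywhere; there the energies coincide.\<close>
      moreover have "Jeps \<Omega> Q \<phi>1 (\<epsilon> k) (uk k) = Jeps \<Omega> Q \<phi>1 (\<epsilon> k) v"
        if "AE x in lebesgue. x \<in> \<Omega> \<longrightarrow> v x = uk k x"
      proof -
        have ae: "AE x in N. v x = uk k x"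
          unfolding N_def AE_restrict_space_iff[OF \<Omega>] by (rule that)
        then have "(LINT x|N. (Q x)\<^sup>2 * \<phi>1 (v x / \<epsilon> k)) = (LINT x|N. (Q x)\<^sup>2 * \<phi>1 (uk k x / \<epsilon> k))"
          using phi_int[OF vH] phi_int[OF uk] by (intro integral_cong_AE) (auto elim: eventually_mono)
        then show ?thesis
          using L2_seminorm_grad_cong_AE[OF dom(1) vH uk ae[unfolded N_def]] by (simp add: Jeps_eq vH uk N_def)
      qed
      ultimately show ?case
        using locmin(2)[OF v, of k] by (cases "AE x in lebesgue. x \<in> \<Omega> \<longrightarrow> v x = uk k x") auto
    qed
  qed

  \<comment> \<open>The squares of the differences converge to zero in L1, which yields a
    subsequence converging almost everywhere.\<close>
  have "(\<lambda>k. LINT x|N. norm ((uk k x - u x)\<^sup>2)) \<longlonglongrightarrow> 0"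
  proof (rule Lim_null_comparison)
    show "(\<lambda>k. (H1_dist \<Omega> (uk k) u)\<^sup>2) \<longlonglongrightarrow> 0"
      using tendsto_power[OF u(2), of 2] by simp
    show "\<forall>\<^sub>F k in sequentially. norm (LINT x|N. norm ((uk k x - u x)\<^sup>2)) \<le> (H1_dist \<Omega> (uk k) u)\<^sup>2"
      using integral_diff_square_le_H1_dist[OF dom(1) uk u(1)] by (simp add: N_def)
  qed
  moreover have "integrable N (\<lambda>x. (uk k x - u x)\<^sup>2)" for k
    using H1_integrable_square[OF dom(1) H1_diff[OF dom(1) uk u(1)]] by (simp add: N_def)
  ultimately obtain r where r: "strict_mono r" and sq: "AE x in N. (\<lambda>n. (uk (r n) x - u x)\<^sup>2) \<longlonglongrightarrow> 0"
    using tendsto_L1_AE_subseq[of N "\<lambda>k x. (uk k x - u x)\<^sup>2"] by blast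
  from sq have ae: "AE x in N. (\<lambda>n. uk (r n) x) \<longlonglongrightarrow> u x"
  proof eventually_elim
    case (elim x)
    have "(\<lambda>n. uk (r n) x - u x) \<longlonglongrightarrow> 0"
      using tendsto_real_sqrt[OF elim] by (simp add: tendsto_rabs_zero_iff)
    then show ?case by (rule LIM_zero_cancel)
  qed
  have eps_r: "(\<lambda>n. \<epsilon> (r n)) \<longlonglongrightarrow> 0"
    using LIMSEQ_subseq_LIMSEQ[OF eps(2) r] by (simp add: o_def)

  \<comment> \<open>Where \<open>u x = 0\<close> the quotients
    \<open>uk (r n) x / \<epsilon> (r n)\<close> are uncontrolled and the potential may fail to
    converge. Truncating by the limit value restores convergence and only lowers the integrand,
    which is the direction needed.\<close>
  define q where "q n x = min (\<phi>1 (uk (r n) x / \<epsilon> (r n))) ((lam lam1 lam2 (u x))\<^sup>2)" for n x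
  have q_meas: "q n \<in> borel_measurable N" for n
    unfolding q_def[abs_def] using H1_meas[OF uk] H1_meas[OF u(1)] by measurable
  have q_bound: "\<bar>q n x\<bar> \<le> lam1\<^sup>2" for n x
    using phi_le[of "uk (r n) x / \<epsilon> (r n)"] lam_bound[of "u x"] by (simp add: q_def min_def)
  have q_lim: "AE x in N. (\<lambda>n. q n x) \<longlonglongrightarrow> (lam lam1 lam2 (u x))\<^sup>2"
    using ae
  proof eventually_elim
    case (elim x)
    have "\<forall>\<^sub>F n in sequentially. q n x = (lam lam1 lam2 (u x))\<^sup>2"
    proof (cases "u x > 0")
      case True
      have "\<forall>\<^sub>F n in sequentially. 1 \<le> uk (r n) x / \<epsilon> (r n)"
        by (rule eventually_scaled_ge_1[OF elim True eps(1) eps_r])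
      then show ?thesis
        by eventually_elim (use True in \<open>simp add: q_def phi(4) lam_def\<close>)
    next
      \<comment> \<open>Here the limit value is the smallest value of the potential, so the minimum
        equals it for every \<open>n\<close>.\<close>
      case False
      then show ?thesis
        using phi_ge by (simp add: q_def lam_def)
    qed
    then show ?case by (rule tendsto_eventually)
  qed
  have "(\<lambda>n. (L2_seminorm N (grad \<Omega> (uk (r n))))\<^sup>2 + (LINT x|N. (Q x)\<^sup>2 * q n x)) \<longlonglongrightarrow> Jfun \<Omega> Q lam1 lam2 u"
    unfolding Jfun_eq[OF u(1)]
  proof (intro tendsto_add tendsto_power)
    have "(\<lambda>n. H1_dist \<Omega> (uk (r n)) u) \<longlonglongrightarrow> 0"
      using LIMSEQ_subseq_LIMSEQ[OF u(2) r] by (simp add: o_def)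
    then show "(\<lambda>n. L2_seminorm N (grad \<Omega> (uk (r n)))) \<longlonglongrightarrow> L2_seminorm N (grad \<Omega> u)"
      unfolding N_def by (intro L2_seminorm_grad_tendsto dom uk u)
    show "(\<lambda>n. LINT x|N. (Q x)\<^sup>2 * q n x) \<longlonglongrightarrow> (LINT x|N. (Q x)\<^sup>2 * (lam lam1 lam2 (u x))\<^sup>2)"
      using H1_meas[OF u(1)] by (intro integral_bounded_mult_tendsto[OF fin _ q_meas _ QM q_bound q_lim]) auto
  qed
  moreover have "(\<lambda>n. Jeps \<Omega> Q \<phi>1 (\<epsilon> (r n)) v) \<longlonglongrightarrow> Jfun \<Omega> Q lam1 lam2 v"
    unfolding Jfun_eq[OF vH] Jeps_eq[OF vH]
  proof (intro tendsto_add tendsto_const)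
    \<comment> \<open>For the fixed function \<open>v\<close> convergence holds at every point: for
      positive values the quotient eventually passes 1, otherwise it stays nonpositive and the
      potential is already the limit value.\<close>
    have lim: "(\<lambda>n. \<phi>1 (v x / \<epsilon> (r n))) \<longlonglongrightarrow> (lam lam1 lam2 (v x))\<^sup>2" for x
    proof (rule tendsto_eventually, cases "v x > 0")
      case True
      show "\<forall>\<^sub>F n in sequentially. \<phi>1 (v x / \<epsilon> (r n)) = (lam lam1 lam2 (v x))\<^sup>2"
        using eventually_scaled_ge_1[OF tendsto_const True eps(1) eps_r]
        by eventually_elim (use True in \<open>simp add: phi(4) lam_def\<close>)
    next
      case False
      then show "\<forall>\<^sub>F n in sequentially. \<phi>1 (v x / \<epsilon> (r n)) = (lam lam1 lam2 (v x))\<^sup>2"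
        using eps(1) by (simp add: phi(5) lam_def divide_le_0_iff less_imp_le not_less)
    qed
    show "(\<lambda>n. LINT x|N. (Q x)\<^sup>2 * \<phi>1 (v x / \<epsilon> (r n))) \<longlonglongrightarrow> (LINT x|N. (Q x)\<^sup>2 * (lam lam1 lam2 (v x))\<^sup>2)"
      using H1_meas[OF vH] lim by (intro integral_bounded_mult_tendsto[OF fin _ _ _ QM phi_le]) auto
  qed
  \<comment> \<open>Truncation lowers the energy of \<open>uk (r n)\<close>, so minimality passes to
    the truncated expression, whose limit is the energy of \<open>u\<close>.\<close>
  moreover have "\<forall>\<^sub>F n in sequentially.
      (L2_seminorm N (grad \<Omega> (uk (r n))))\<^sup>2 + (LINT x|N. (Q x)\<^sup>2 * q n x) \<le> Jeps \<Omega> Q \<phi>1 (\<epsilon> (r n)) v"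
    using eventually_subseq[OF r Jeps_le]
  proof eventually_elim
    case (elim n)
    have "(LINT x|N. (Q x)\<^sup>2 * q n x) \<le> (LINT x|N. (Q x)\<^sup>2 * \<phi>1 (uk (r n) x / \<epsilon> (r n)))"
      using phi_int[OF uk] integrable_bounded_mult[OF fin _ q_meas QM q_bound]
      by (intro integral_mono) (auto simp: q_def intro: mult_left_mono)
    then show ?case
      using elim Jeps_eq[OF uk] by simp
  qed
  ultimately show "Jfun \<Omega> Q lam1 lam2 u \<le> Jfun \<Omega> Q lam1 lam2 v"
    by (intro tendsto_le[OF sequentially_bot]) auto
qed

end
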